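(* Let $G=(V,E)$ be a finite simple connected graph. Then $\beth^{1}(K^{\chi(G)})\le \beth^{1}(G)$; that is, $$\binom{\chi(G)}{2}-\binom{\chi(G)}{1}\le |E|-|V|.$$
   Context: All graphs are finite and simple. $K^{t}$ is the complete graph on $t$ vertices and $\chi(G)$ is the chromatic number of $G$. For a connected graph $G$, the first graph characteristic is $\beth^{1}(G)=|E(G)|-|V(G)|$. *)

theory Defs
  imports Complex_Main
begin

record 'a graph =
  verts :: "'a set"
  edges :: "'a set set"

definition simple_graph :: "'a graph \<Rightarrow> bool" where
  "simple_graph G \<longleftrightarrow> finite (verts G) \<and> (\<forall>e\<in>edges G. e \<subseteq> verts G \<and> card e = 2)"

definition adj :: "'a graph \<Rightarrow> ('a \<times> 'a) set" where
  "adj G = {(u, v). {u, v} \<in> edges G}"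

text \<open>As usual, the graph without vertices is not regarded as connected.\<close>

definition connected_graph :: "'a graph \<Rightarrow> bool" where
  "connected_graph G \<longleftrightarrow>
     verts G \<noteq> {} \<and> (\<forall>u\<in>verts G. \<forall>v\<in>verts G. (u, v) \<in> (adj G)\<^sup>*)"

definition proper_colouring :: "'a graph \<Rightarrow> nat \<Rightarrow> ('a \<Rightarrow> nat) \<Rightarrow> bool" where
  "proper_colouring G k c \<longleftrightarrow>
     c ` verts G \<subseteq> {..<k} \<and> (\<forall>u v. {u, v} \<in> edges G \<longrightarrow> c u \<noteq> c v)"

definition chromatic_number :: "'a graph \<Rightarrow> nat" where
  "chromatic_number G = (LEAST k. \<exists>c. proper_colouring G k c)"

definition complete_graph :: "nat \<Rightarrow> nat graph" where
  "complete_graph t = \<lparr>verts = {..<t}, edges = {e. e \<subseteq> {..<t} \<and> card e = 2}\<rparr>"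

definition beth1 :: "'a graph \<Rightarrow> int" where
  "beth1 G = int (card (edges G)) - int (card (verts G))"

end

theory Submission
  imports Defs
begin

text \<open>
  Let \<open>k\<close> be the chromatic number and choose an inclusion-minimal set \<open>H\<close> of vertices whose
  induced subgraph has no proper colouring with \<open>k - 1\<close> colours. By minimality every vertex of
  \<open>G[H]\<close> has degree at least \<open>k - 1\<close>, and \<open>|H| \<ge> k\<close>, so for \<open>k \<ge> 3\<close> the handshake identity
  gives \<open>|E(G[H])| - |H| \<ge> |H| (k - 3) / 2 \<ge> k (k - 3) / 2\<close>. By connectedness, growing \<open>H\<close> to
  \<open>V\<close> one vertex at a time uses a new edge at each step, so \<open>|E| - |V| \<ge> |E(G[H])| - |H|\<close>. For
  \<open>k \<le> 2\<close> the same growth argument is started from a single vertex.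
\<close>

section \<open>Induced subgraphs and elementary facts on simple graphs\<close>

definition induced_subgraph :: "'a graph \<Rightarrow> 'a set \<Rightarrow> 'a graph" where
  "induced_subgraph G H = \<lparr>verts = H, edges = {e \<in> edges G. e \<subseteq> H}\<rparr>"

lemma verts_induced_subgraph [simp]: "verts (induced_subgraph G H) = H"
  and edges_induced_subgraph [simp]: "edges (induced_subgraph G H) = {e \<in> edges G. e \<subseteq> H}"
  by (simp_all add: induced_subgraph_def)

lemma simple_graph_finite_verts: "simple_graph G \<Longrightarrow> finite (verts G)"
  and simple_graph_edge_subset: "simple_graph G \<Longrightarrow> e \<in> edges G \<Longrightarrow> e \<subseteq> verts G"
  and simple_graph_card_edge: "simple_graph G \<Longrightarrow> e \<in> edges G \<Longrightarrow> card e = 2"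
  by (auto simp: simple_graph_def)

lemma simple_graph_finite_edges:
  assumes "simple_graph G"
  shows "finite (edges G)"
proof (rule finite_subset)
  show "edges G \<subseteq> Pow (verts G)"
    using simple_graph_edge_subset[OF assms] by blast
  show "finite (Pow (verts G))"
    using simple_graph_finite_verts[OF assms] by simp
qed

lemma simple_graph_induced_subgraph:
  assumes "simple_graph G" "H \<subseteq> verts G"
  shows "simple_graph (induced_subgraph G H)"
  using assms by (auto simp: simple_graph_def intro: finite_subset)

lemma simple_graph_edge_neq:
  assumes "simple_graph G" "{u, v} \<in> edges G"
  shows "u \<noteq> v"
  using simple_graph_card_edge[OF assms] by auto

section \<open>Colourings and the chromatic number\<close>

lemma proper_colouring_card_verts:
  assumes "simple_graph G" "card (verts G) \<le> k"
  shows "\<exists>c. proper_colouring G k c"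
proof -
  have "finite (verts G)"
    using assms(1) by (rule simple_graph_finite_verts)
  then obtain c where c: "c ` verts G \<subseteq> {..<k}" "inj_on c (verts G)"
    using card_le_inj[of "verts G" "{..<k}"] assms(2) by auto
  have "c u \<noteq> c v" if "{u, v} \<in> edges G" for u v
    using simple_graph_edge_neq[OF assms(1) that] simple_graph_edge_subset[OF assms(1) that]
      inj_onD[OF c(2), of u v] by auto
  with c(1) show ?thesis
    by (auto simp: proper_colouring_def)
qed

text \<open>Some number of colours always suffices, namely the number of vertices, so the
  \<open>LEAST\<close> in \<open>chromatic_number\<close> is attained.\<close>

lemma proper_colouring_chromatic_number:
  assumes "simple_graph G"
  shows "\<exists>c. proper_colouring G (chromatic_number G) c"
  unfolding chromatic_number_def
  by (rule LeastI_ex) (use proper_colouring_card_verts[OF assms] in blast)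

lemma not_proper_colouring_below_chromatic_number:
  assumes "k < chromatic_number G"
  shows "\<not> proper_colouring G k c"
  using not_less_Least[of k "\<lambda>k. \<exists>c. proper_colouring G k c"] assms
  by (auto simp: chromatic_number_def)

lemma chromatic_number_pos:
  assumes "simple_graph G" "verts G \<noteq> {}"
  shows "chromatic_number G > 0"
proof (rule ccontr)
  assume "\<not> chromatic_number G > 0"
  then obtain c where "proper_colouring G 0 c"
    using proper_colouring_chromatic_number[OF assms(1)] by auto
  with assms(2) show False
    by (auto simp: proper_colouring_def)
qed

section \<open>Growing a vertex set in a connected graph\<close>

lemma connected_graph_edge_leaving:
  assumes "connected_graph G" "H \<subseteq> verts G" "H \<noteq> {}" "H \<noteq> verts G"
  obtains u v where "u \<in> H" "v \<notin> H" "{u, v} \<in> edges G"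
proof -
  from assms obtain a b where ab: "a \<in> H" "b \<in> verts G" "b \<notin> H"
    by blast
  have "(a, b) \<in> (adj G)\<^sup>*"
    using assms(1,2) ab by (auto simp: connected_graph_def)
  \<comment> \<open>If no edge left \<open>H\<close>, every vertex reachable from \<open>a\<close>
    would stay in \<open>H\<close>; this contradicts the choice of \<open>b\<close>.\<close>
  then have "b \<in> H" if "\<And>u v. u \<in> H \<Longrightarrow> {u, v} \<in> edges G \<Longrightarrow> v \<in> H"
    by (induction rule: rtrancl_induct) (use ab(1) that in \<open>auto simp: adj_def\<close>)
  with ab(3) that show thesis
    by blast
qed

text \<open>Induction on the number of vertices outside \<open>H\<close>: absorbing the outer
  endpoint \<open>v\<close> of an edge leaving \<open>H\<close> removes one outside vertex and at
  least that edge from the right-hand set.\<close>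

lemma connected_graph_card_edges_outside:
  assumes "simple_graph G" "connected_graph G" "H \<subseteq> verts G" "H \<noteq> {}"
  shows "card (verts G - H) \<le> card {e \<in> edges G. \<not> e \<subseteq> H}"
  using assms(3,4)
proof (induction "card (verts G - H)" arbitrary: H)
  case 0
  then show ?case by simp
next
  case (Suc n)
  then have "H \<noteq> verts G" by auto
  with Suc.prems obtain u v where uv: "u \<in> H" "v \<notin> H" "{u, v} \<in> edges G"
    using connected_graph_edge_leaving[OF assms(2)] by blast
  have v: "v \<in> verts G"
    using simple_graph_edge_subset[OF assms(1) uv(3)] by simp
  have fin: "finite (verts G)" "finite (edges G)"
    using assms(1) by (simp_all add: simple_graph_finite_verts simple_graph_finite_edges)
  have "verts G - insert v H = (verts G - H) - {v}"
    by auto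
  then have "n = card (verts G - insert v H)"
    using Suc.hyps(2) v uv(2) fin by simp
  then have "n \<le> card {e \<in> edges G. \<not> e \<subseteq> insert v H}"
    using Suc.hyps(1)[of "insert v H"] Suc.prems v by simp
  also have "\<dots> < card {e \<in> edges G. \<not> e \<subseteq> H}"
  proof (rule psubset_card_mono)
    have "{u, v} \<in> {e \<in> edges G. \<not> e \<subseteq> H} - {e \<in> edges G. \<not> e \<subseteq> insert v H}"
      using uv by simp
    then show "{e \<in> edges G. \<not> e \<subseteq> insert v H} \<subset> {e \<in> edges G. \<not> e \<subseteq> H}"
      by blast
  qed (use fin in simp)
  finally show ?case
    using Suc.hyps(2) by simp
qed

lemma beth1_induced_subgraph_le:
  assumes "simple_graph G" "connected_graph G" "H \<subseteq> verts G" "H \<noteq> {}"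
  shows "beth1 (induced_subgraph G H) \<le> beth1 G"
proof -
  have fin: "finite (verts G)" "finite (edges G)"
    using assms(1) by (simp_all add: simple_graph_finite_verts simple_graph_finite_edges)
  have "card ({e \<in> edges G. e \<subseteq> H} \<union> {e \<in> edges G. \<not> e \<subseteq> H}) =
      card {e \<in> edges G. e \<subseteq> H} + card {e \<in> edges G. \<not> e \<subseteq> H}"
    using fin by (intro card_Un_disjoint) auto
  moreover have "{e \<in> edges G. e \<subseteq> H} \<union> {e \<in> edges G. \<not> e \<subseteq> H} = edges G"
    by blast
  ultimately have "card (edges G) = card {e \<in> edges G. e \<subseteq> H} + card {e \<in> edges G. \<not> e \<subseteq> H}"
    by simp
  moreover have "card (verts G) = card H + card (verts G - H)"
    using fin assms(3) by (simp add: card_Diff_subset card_mono finite_subset)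
  ultimately show ?thesis
    using connected_graph_card_edges_outside[OF assms] by (simp add: beth1_def)
qed

section \<open>Degrees and critical subgraphs\<close>

lemma handshake:
  assumes "simple_graph G"
  shows "(\<Sum>v\<in>verts G. card {e \<in> edges G. v \<in> e}) = 2 * card (edges G)"
proof (rule sum_multicount)
  show "\<forall>e\<in>edges G. card {v \<in> verts G. v \<in> e} = 2"
  proof
    fix e assume e: "e \<in> edges G"
    then have "{v \<in> verts G. v \<in> e} = e"
      using simple_graph_edge_subset[OF assms] by blast
    with e show "card {v \<in> verts G. v \<in> e} = 2"
      using simple_graph_card_edge[OF assms] by simp
  qed
qed (use assms in \<open>simp_all add: simple_graph_finite_verts simple_graph_finite_edges\<close>)

text \<open>With fewer than \<open>k\<close> edges at \<open>v\<close>, some colour below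
  \<open>k\<close> would be missing on its neighbours; giving it to \<open>v\<close> would extend
  \<open>c\<close> to all of \<open>G\<close>.\<close>

lemma critical_graph_degree:
  assumes "simple_graph G" "v \<in> verts G"
    and "\<And>c. \<not> proper_colouring G k c"
    and "proper_colouring (induced_subgraph G (verts G - {v})) k c"
  shows "k \<le> card {e \<in> edges G. v \<in> e}"
proof (rule ccontr)
  define N where "N = {u. {v, u} \<in> edges G}"
  assume "\<not> k \<le> card {e \<in> edges G. v \<in> e}"
  moreover have "card N \<le> card {e \<in> edges G. v \<in> e}"
  proof (rule card_inj_on_le)
    \<comment> \<open>Distinct neighbours give distinct edges at \<open>v\<close>, so the degree
      bounds the number of neighbours.\<close>
    show "inj_on (\<lambda>u. {v, u}) N"
      by (auto simp: inj_on_def doubleton_eq_iff)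
  qed (use simple_graph_finite_edges[OF assms(1)] in \<open>auto simp: N_def\<close>)
  moreover have "N \<subseteq> verts G"
    using simple_graph_edge_subset[OF assms(1)] by (auto simp: N_def)
  then have "finite N"
    using simple_graph_finite_verts[OF assms(1)] by (rule finite_subset)
  then have "card (c ` N) \<le> card N" "finite (c ` N)"
    by (simp_all add: card_image_le)
  ultimately have "\<not> {..<k} \<subseteq> c ` N"
    using card_mono[of "c ` N" "{..<k}"] by auto
  then obtain i where i: "i < k" "i \<notin> c ` N"
    by auto
  have col: "(c(v := i)) x \<noteq> (c(v := i)) y" if xy: "{x, y} \<in> edges G" for x y
  proof -
    have ne: "x \<noteq> y" and sub: "{x, y} \<subseteq> verts G"
      using simple_graph_edge_neq[OF assms(1) xy] simple_graph_edge_subset[OF assms(1) xy] by auto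
    consider "x = v" | "y = v" | "x \<noteq> v" "y \<noteq> v" by blast
    then show ?thesis
    proof cases
      case 1
      with xy have "y \<in> N" by (simp add: N_def)
      with 1 i ne show ?thesis by auto
    next
      case 2
      with xy have "x \<in> N" by (simp add: N_def insert_commute)
      with 2 i ne show ?thesis by auto
    next
      case 3
      with xy sub assms(4) show ?thesis
        by (auto simp: proper_colouring_def)
    qed
  qed
  have "(c(v := i)) ` verts G \<subseteq> {..<k}"
    using assms(4) i(1) by (auto simp: proper_colouring_def)
  with col have "proper_colouring G k (c(v := i))"
    by (simp add: proper_colouring_def)
  with assms(3) show False
    by blast
qed

text \<open>Take \<open>H\<close> inclusion-minimal among the sets inducing a subgraph that is not
  \<open>k\<close>-colourable. It has more than \<open>k\<close> vertices, since otherwise an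
  injective colouring would do, and summing the degree bound over \<open>H\<close> gives the edge
  count.\<close>

lemma critical_induced_subgraph:
  assumes "simple_graph G" "\<And>c. \<not> proper_colouring G k c"
  obtains H where "H \<subseteq> verts G" "k < card H"
    "card H * k \<le> 2 * card (edges (induced_subgraph G H))"
proof -
  define F where "F = {H. H \<subseteq> verts G \<and> (\<forall>c. \<not> proper_colouring (induced_subgraph G H) k c)}"
  have "{e \<in> edges G. e \<subseteq> verts G} = edges G"
    using simple_graph_edge_subset[OF assms(1)] by blast
  then have "induced_subgraph G (verts G) = G"
    by (simp add: induced_subgraph_def)
  with assms(2) have "verts G \<in> F"
    by (simp add: F_def)
  moreover have "finite F"
    using simple_graph_finite_verts[OF assms(1)] by (simp add: F_def)
  ultimately obtain H where H: "H \<in> F" and min: "\<And>H'. H' \<in> F \<Longrightarrow> H' \<subseteq> H \<Longrightarrow> H' = H"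
    using finite_has_minimal[of F] by blast
  from H have HV: "H \<subseteq> verts G" and nocol: "\<And>c. \<not> proper_colouring (induced_subgraph G H) k c"
    by (auto simp: F_def)
  let ?K = "induced_subgraph G H"
  have K: "simple_graph ?K"
    using simple_graph_induced_subgraph[OF assms(1) HV] .
  have "k < card H"
    using proper_colouring_card_verts[OF K, of k] nocol
    by (metis not_le verts_induced_subgraph)
  moreover have "k \<le> card {e \<in> edges ?K. v \<in> e}" if v: "v \<in> H" for v
  proof -
    \<comment> \<open>Minimality makes the subgraph without \<open>v\<close> colourable, as the
      degree lemma requires.\<close>
    have "H - {v} \<notin> F"
      using min[of "H - {v}"] v by blast
    then obtain c where c: "proper_colouring (induced_subgraph G (H - {v})) k c"
      using HV by (auto simp: F_def)
    have "induced_subgraph ?K (verts ?K - {v}) = induced_subgraph G (H - {v})"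
      by (auto simp: induced_subgraph_def)
    with c have "proper_colouring (induced_subgraph ?K (verts ?K - {v})) k c"
      by simp
    then show ?thesis
      using critical_graph_degree[OF K] v nocol by simp
  qed
  then have "card H * k \<le> (\<Sum>v\<in>H. card {e \<in> edges ?K. v \<in> e})"
    using sum_bounded_below[of H k "\<lambda>v. card {e \<in> edges ?K. v \<in> e}"] by simp
  then have "card H * k \<le> 2 * card (edges ?K)"
    using handshake[OF K] by simp
  ultimately show thesis
    using HV that by blast
qed

section \<open>Arithmetic and the final estimate\<close>

lemma int_choose_two: "2 * int (n choose 2) = int n * (int n - 1)"
proof -
  \<comment> \<open>Parity makes the division by 2 in \<open>choose_two\<close> exact.\<close>
  have "even (n * (n - 1))"
    by (cases n) auto
  then have "2 * (n choose 2) = n * (n - 1)"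
    unfolding choose_two by (rule dvd_mult_div_cancel)
  then have "2 * int (n choose 2) = int (n * (n - 1))"
    by (metis of_nat_mult of_nat_numeral)
  then show ?thesis
    by (cases n) (simp_all add: algebra_simps)
qed

lemma beth1_complete_graph: "beth1 (complete_graph t) = int (t choose 2) - int t"
  by (simp add: beth1_def complete_graph_def n_subsets)

lemma beth1_chromatic_number:
  assumes "simple_graph G" "connected_graph G"
  shows "int (chromatic_number G choose 2) - int (chromatic_number G) \<le> beth1 G"
proof -
  define k where "k = chromatic_number G"
  have ne: "verts G \<noteq> {}"
    using assms(2) by (simp add: connected_graph_def)
  have "k > 0"
    using chromatic_number_pos[OF assms(1) ne] by (simp add: k_def)
  show ?thesis
  proof (cases "k \<ge> 3")
    \<comment> \<open>Here \<open>int k - 3\<close> is negative, so replacing \<open>card H\<close>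
      by \<open>k\<close> would not give a lower bound. Both small values of \<open>k\<close> give
      left-hand side -1, matched by a single vertex.\<close>
    case False
    with \<open>k > 0\<close> have "k = 1 \<or> k = 2"
      by linarith
    then have "int (k choose 2) - int k = - 1"
      by auto
    moreover from ne obtain v where "v \<in> verts G"
      by blast
    then have "beth1 (induced_subgraph G {v}) \<le> beth1 G"
      using beth1_induced_subgraph_le[OF assms] by simp
    moreover have "- 1 \<le> beth1 (induced_subgraph G {v})"
      by (simp add: beth1_def)
    ultimately show ?thesis
      by (simp add: k_def)
  next
    case True
    have "\<not> proper_colouring G (k - 1) c" for c
      using \<open>k > 0\<close> by (intro not_proper_colouring_below_chromatic_number) (simp add: k_def)
    then obtain H where H: "H \<subseteq> verts G" "k - 1 < card H"
      "card H * (k - 1) \<le> 2 * card (edges (induced_subgraph G H))"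
      using critical_induced_subgraph[OF assms(1)] by blast
    have "H \<noteq> {}"
      using H(2) by auto
    \<comment> \<open>Positivity of \<open>k\<close> lets the truncated subtraction
      \<open>k - 1\<close> pass to the integers.\<close>
    have "int (card H) * (int k - 1) = int (card H * (k - 1))"
      using \<open>k > 0\<close> by simp
    also have "\<dots> \<le> 2 * int (card (edges (induced_subgraph G H)))"
      using H(3) by linarith
    finally have "int (card H) * (int k - 3) \<le> 2 * beth1 (induced_subgraph G H)"
      by (simp add: beth1_def algebra_simps)
    \<comment> \<open>The strict bound \<open>k - 1 < card H\<close> yields
      \<open>k \<le> card H\<close>, and the factor \<open>int k - 3\<close> is nonnegative in this
      case.\<close>
    moreover have "int k * (int k - 3) \<le> int (card H) * (int k - 3)"
      using H(2) True by (intro mult_right_mono) auto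
    moreover have "beth1 (induced_subgraph G H) \<le> beth1 G"
      using beth1_induced_subgraph_le[OF assms H(1) \<open>H \<noteq> {}\<close>] .
    moreover have "2 * (int (k choose 2) - int k) = int k * (int k - 3)"
      using int_choose_two[of k] by (simp add: algebra_simps)
    ultimately have "2 * (int (k choose 2) - int k) \<le> 2 * beth1 G"
      by linarith
    then show ?thesis
      by (simp add: k_def)
  qed
qed

theorem corollary2p2p1:
  fixes G :: "'a graph"
  assumes "simple_graph G" and "connected_graph G"
  shows "beth1 (complete_graph (chromatic_number G)) \<le> beth1 G \<and>
         int (chromatic_number G choose 2) - int (chromatic_number G choose 1)
           \<le> int (card (edges G)) - int (card (verts G))"
  using beth1_chromatic_number[OF assms] by (simp add: beth1_complete_graph beth1_def[of G])

end
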